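(* Every threshold graph is clique tree universal; that is, if $G$ is a threshold graph with set $\mathcal{M}_G$ of maximal cliques, then every tree on $|\mathcal{M}_G|$ nodes is a clique tree of $G$.
   Context: All graphs are finite and simple. A graph $G$ is $(K,I)$-split if $V(G)$ is partitioned into a clique $K$ and an independent set $I$ (either may be empty). A set $U\subseteq V(G)$ has the nested neighborhood property in $G$ if its vertices can be listed as $v_1,\ldots,v_{|U|}$ so that $N_G(v_i)\subseteq N_G(v_{i+1})$ for each $i\in\{1,\ldots,|U|-1\}$, where $N_G(v)$ is the set of neighbors of $v$. $G$ is a threshold graph if it is $(K,I)$-split for some $K,I$ such that $I$ has the nested neighborhood property in $G$. Maximal cliques are inclusion-maximal sets of pairwise adjacent vertices. A tree $T$ is a clique tree of a chordal graph $G$ (every threshold graph is chordal) if there is a bijection $\sigma:V(T)\to\mathcal{M}_G$ such that for every $v\in V(G)$, the subgraph of $T$ induced by the nodes $\{u\in V(T):v\in\sigma(u)\}$ is a subtree of $T$ (i.e. is connected). A chordal graph $G$ is clique tree universal if every tree on $|\mathcal{M}_G|$ nodes is a clique tree of $G$. *)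

theory Defs
  imports "Graph_Theory.Digraph_Component"
begin

text \<open>A finite simple graph is a symmetric, loop-free, finite digraph (locale \<open>pair_graph\<close>); the
  undirected edge \<open>uv\<close> is the pair of arcs \<open>(u,v)\<close>, \<open>(v,u)\<close>.\<close>

definition nbhd :: "'a pair_pre_digraph \<Rightarrow> 'a \<Rightarrow> 'a set" where
  "nbhd G v = {w. (v, w) \<in> parcs G}"

definition clique :: "'a pair_pre_digraph \<Rightarrow> 'a set \<Rightarrow> bool" where
  "clique G C \<longleftrightarrow> C \<subseteq> pverts G \<and> pairwise (\<lambda>u v. (u, v) \<in> parcs G) C"

definition independent_set :: "'a pair_pre_digraph \<Rightarrow> 'a set \<Rightarrow> bool" where
  "independent_set G S \<longleftrightarrow> S \<subseteq> pverts G \<and> pairwise (\<lambda>u v. (u, v) \<notin> parcs G) S"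

definition split_graph :: "'a pair_pre_digraph \<Rightarrow> 'a set \<Rightarrow> 'a set \<Rightarrow> bool" where
  "split_graph G K I \<longleftrightarrow> K \<union> I = pverts G \<and> K \<inter> I = {} \<and> clique G K \<and> independent_set G I"

definition nested_neighborhoods :: "'a pair_pre_digraph \<Rightarrow> 'a set \<Rightarrow> bool" where
  "nested_neighborhoods G U \<longleftrightarrow>
     (\<exists>vs. distinct vs \<and> set vs = U \<and>
        (\<forall>i. Suc i < length vs \<longrightarrow> nbhd G (vs ! i) \<subseteq> nbhd G (vs ! Suc i)))"

definition threshold_graph :: "'a pair_pre_digraph \<Rightarrow> bool" where
  "threshold_graph G \<longleftrightarrow> pair_graph G \<and> (\<exists>K I. split_graph G K I \<and> nested_neighborhoods G I)"

definition maximal_cliques :: "'a pair_pre_digraph \<Rightarrow> 'a set set" where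
  "maximal_cliques G = {C. clique G C \<and> (\<forall>D. clique G D \<and> C \<subseteq> D \<longrightarrow> D = C)}"

text \<open>The library's \<open>cycle\<close> is a directed cycle, given by its list of arcs. In a symmetric digraph it
  admits the closed walk \<open>u, v, u\<close>; undirected cycles are those with at least three arcs. For the
  same reason the library's \<open>forest\<close> and \<open>tree\<close> do not describe undirected forests and trees.\<close>

definition graph_cycle :: "'a pair_pre_digraph \<Rightarrow> ('a \<times> 'a) list \<Rightarrow> bool" where
  "graph_cycle G p \<longleftrightarrow> pre_digraph.cycle (with_proj G) p \<and> 3 \<le> length p"

definition graph_tree :: "'a pair_pre_digraph \<Rightarrow> bool" where
  "graph_tree T \<longleftrightarrow> pair_graph T \<and> connected (with_proj T) \<and> (\<nexists>p. graph_cycle T p)"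

definition chord :: "'a pair_pre_digraph \<Rightarrow> ('a \<times> 'a) list \<Rightarrow> 'a \<Rightarrow> 'a \<Rightarrow> bool" where
  "chord G p u v \<longleftrightarrow> u \<in> fst ` set p \<and> v \<in> fst ` set p \<and>
     (u, v) \<in> parcs G \<and> (u, v) \<notin> set p \<and> (v, u) \<notin> set p"

definition chordal :: "'a pair_pre_digraph \<Rightarrow> bool" where
  "chordal G \<longleftrightarrow> pair_graph G \<and> (\<forall>p. graph_cycle G p \<and> 4 \<le> length p \<longrightarrow> (\<exists>u v. chord G p u v))"

text \<open>\<open>\<restriction>\<close> is the induced subgraph.\<close>

definition clique_tree :: "'b pair_pre_digraph \<Rightarrow> 'a pair_pre_digraph \<Rightarrow> bool" where
  "clique_tree T G \<longleftrightarrow> graph_tree T \<and>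
     (\<exists>\<sigma>. bij_betw \<sigma> (pverts T) (maximal_cliques G) \<and>
        (\<forall>v \<in> pverts G. connected (with_proj T \<restriction> {u \<in> pverts T. v \<in> \<sigma> u})))"

text \<open>HOL cannot quantify over the node type of \<open>T\<close> inside a definition, so it is a type parameter;
  ``every tree'' is obtained by leaving it an arbitrary type variable.\<close>

definition clique_tree_universal :: "'b itself \<Rightarrow> 'a pair_pre_digraph \<Rightarrow> bool" where
  "clique_tree_universal _ G \<longleftrightarrow> chordal G \<and>
     (\<forall>T :: 'b pair_pre_digraph. graph_tree T \<and> card (pverts T) = card (maximal_cliques G)
        \<longrightarrow> clique_tree T G)"

end

theory Submission
  imports Defs
begin

text \<open>Split \<open>G\<close> into a clique \<open>K\<close> and an independent set \<open>I\<close> with nested neighborhoods. The maximal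
  cliques are the closed neighborhoods of the vertices of \<open>I\<close>, and \<open>K\<close> itself unless some vertex of \<open>I\<close>
  is adjacent to all of it; listed by decreasing trace on \<open>K\<close>, those containing a given
  vertex of \<open>K\<close> form a nonempty prefix, whereas a vertex of \<open>I\<close> lies in exactly one. The nodes of a finite
  connected graph can be listed so that every nonempty prefix induces a connected subgraph, so
  matching the two lists gives the clique tree. Chordality holds because the two neighbors on a cycle
  of a vertex of \<open>I\<close> lie in \<open>K\<close>.\<close>

section \<open>Connected prefixes\<close>

lemma parcs_mk_symmetric_induce:
  "parcs (mk_symmetric (G \<restriction> S)) = parcs (mk_symmetric G) \<inter> S \<times> S"
  by (auto simp: parcs_mk_symmetric)

lemma connected_induce_singleton: "connected (G \<restriction> {x})"
  by (auto simp: connected_def strongly_connected_def reachable_def)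

text \<open>Walks inside \<open>S\<close> survive in the larger induced subgraph, so
  \<open>s\<close> reaches all of \<open>insert x S\<close>. Symmetry of \<open>mk_symmetric\<close>
  reverses these walks, and any two vertices are then joined through \<open>s\<close>.\<close>

lemma connected_induce_insert:
  assumes conn: "connected (G \<restriction> S)" and "s \<in> S" and arc: "(s, x) \<in> parcs (mk_symmetric G)"
  shows "connected (G \<restriction> insert x S)"
proof -
  let ?H = "mk_symmetric (G \<restriction> S)" and ?H' = "mk_symmetric (G \<restriction> insert x S)"
  have mono: "u \<rightarrow>\<^sup>*\<^bsub>?H'\<^esub> v" if "u \<rightarrow>\<^sup>*\<^bsub>?H\<^esub> v" for u v
    using that unfolding reachable_def
    by (rule rtrancl_on_mono[rotated 2]) (auto simp: parcs_mk_symmetric_induce)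
  have reach: "s \<rightarrow>\<^sup>*\<^bsub>?H'\<^esub> v" if "v \<in> insert x S" for v
  proof (cases "v \<in> S")
    case True
    then show ?thesis
      using conn \<open>s \<in> S\<close> by (auto simp: connected_def strongly_connected_def intro: mono)
  next
    case False
    have "(s, s) \<in> rtrancl_on (insert x S) (parcs ?H')"
      using \<open>s \<in> S\<close> by auto
    moreover have "(s, x) \<in> parcs ?H'"
      using \<open>s \<in> S\<close> arc by (auto simp: parcs_mk_symmetric_induce)
    ultimately show ?thesis
      using that False by (auto simp: reachable_def intro: rtrancl_on_into_rtrancl_on)
  qed
  have "u \<rightarrow>\<^sup>*\<^bsub>?H'\<^esub> v" if "u \<in> insert x S" "v \<in> insert x S" for u v
    using symmetric_reachable[OF symmetric_mk_symmetric reach[OF that(1)]] reach[OF that(2)]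
    unfolding reachable_def by (rule rtrancl_on_trans)
  then show ?thesis
    by (auto simp: connected_def strongly_connected_def)
qed

text \<open>A walk from a vertex of \<open>S\<close> to a vertex outside must leave \<open>S\<close>
  at some arc; induction along the walk finds it.\<close>

lemma connected_arc_out_of_proper_subset:
  assumes "connected G" "S \<subset> verts G" "S \<noteq> {}"
  obtains s x where "s \<in> S" "x \<in> verts G - S" "(s, x) \<in> parcs (mk_symmetric G)"
proof -
  obtain r y where r: "r \<in> S" "y \<in> verts G" "y \<notin> S"
    using assms by auto
  have "(r, y) \<in> rtrancl_on (verts G) (parcs (mk_symmetric G))"
    using assms r by (auto simp: connected_def strongly_connected_def reachable_def)
  then have "y \<notin> S \<longrightarrow> (\<exists>s x. s \<in> S \<and> x \<in> verts G - S \<and> (s, x) \<in> parcs (mk_symmetric G))"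
    by (induction rule: rtrancl_on_induct) (use r in auto)
  then show thesis
    using r that by blast
qed

text \<open>The list is grown greedily, each new vertex being adjacent to an earlier one. The bound
  \<open>0 < k\<close> matters because \<open>connected\<close> demands a nonempty vertex
  set.\<close>

lemma connected_prefix_enumeration:
  assumes "connected G" "finite (verts G)"
  obtains us where "distinct us" "set us = verts G"
    "\<And>k. 0 < k \<Longrightarrow> k \<le> length us \<Longrightarrow> connected (G \<restriction> set (take k us))"
proof -
  have "\<exists>us. distinct us \<and> set us \<subseteq> verts G \<and> length us = n \<and>
          (\<forall>k. 0 < k \<and> k \<le> n \<longrightarrow> connected (G \<restriction> set (take k us)))"
    if "n \<le> card (verts G)" for n
    using that
  proof (induction n)
    case 0
    then show ?case by simp
  next
    case (Suc n)
    then obtain us where us: "distinct us" "set us \<subseteq> verts G" "length us = n"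
      and conn: "\<And>k. 0 < k \<Longrightarrow> k \<le> n \<Longrightarrow> connected (G \<restriction> set (take k us))"
      by auto
    obtain x where x: "x \<in> verts G - set us" "connected (G \<restriction> insert x (set us))"
    proof (cases "us = []")
      case True
      obtain x where "x \<in> verts G"
        using assms by (auto simp: connected_def strongly_connected_def)
      then show thesis
        using True that by (auto simp: connected_induce_singleton)
    next
      case False
      have "set us \<noteq> verts G"
        using us Suc.prems distinct_card[of us] by auto
      then obtain s x where "s \<in> set us" "x \<in> verts G - set us" "(s, x) \<in> parcs (mk_symmetric G)"
        using connected_arc_out_of_proper_subset[OF assms(1), of "set us"] us False by auto
      moreover have "connected (G \<restriction> set us)"
        using conn[of n] us False by auto
      ultimately show thesis
        using that connected_induce_insert by metis
    qed
    have "connected (G \<restriction> set (take k (us @ [x])))" if "0 < k" "k \<le> Suc n" for k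
      using that x(2) conn[of k] us(3) by (cases "k = Suc n") auto
    then show ?case
      using us x by (intro exI[of _ "us @ [x]"]) auto
  qed
  from this[of "card (verts G)"] obtain us where "distinct us" "set us \<subseteq> verts G"
    "length us = card (verts G)"
    "\<forall>k. 0 < k \<and> k \<le> length us \<longrightarrow> connected (G \<restriction> set (take k us))"
    by auto
  moreover from this have "set us = verts G"
    using assms(2) by (metis card_subset_eq distinct_card)
  ultimately show thesis
    using that by auto
qed

section \<open>Threshold graphs\<close>

lemma split_graph_nbhd_independent:
  assumes "pair_graph G" "split_graph G K I" "w \<in> I"
  shows "nbhd G w \<subseteq> K"
proof
  fix x assume x: "x \<in> nbhd G w"
  interpret pair_graph G by fact
  have "x \<in> pverts G" "x \<noteq> w" "(w, x) \<in> parcs G"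
    using x no_loops'[of w x] in_arcsD2[of w x] by (auto simp: nbhd_def)
  then show "x \<in> K"
    using assms by (auto simp: split_graph_def independent_set_def pairwise_def)
qed

section \<open>Chordality\<close>

lemma cas_heads_eq_tails:
  assumes "pre_digraph.cas (with_proj G) u p v"
  shows "u # map snd p = map fst p @ [v]"
  using assms
  by (induction p arbitrary: u) (auto simp: pre_digraph.cas.simps)

text \<open>Names five consecutive vertices of a long cycle. On a 4-cycle \<open>e\<close> coincides
  with \<open>a\<close>, so \<open>e\<close> is only claimed to be a tail of some arc of
  \<open>p\<close>.\<close>

lemma graph_cycle_expand:
  assumes "pair_graph G" "graph_cycle G p" "4 \<le> length p"
  obtains a b c d e q where "p = (a, b) # (b, c) # (c, d) # (d, e) # q"
    "e \<in> fst ` set p" "distinct (map fst p)" "distinct (map snd p)" "set p \<subseteq> parcs G"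
proof -
  interpret pair_graph G by fact
  obtain u where u: "awalk u p u" "distinct (tl (awalk_verts u p))" "p \<noteq> []"
    using assms(2) by (auto simp: graph_cycle_def cycle_def)
  have cas: "cas u p u"
    using u(1) by (auto simp: awalk_def)
  have eq: "u # map snd p = map fst p @ [u]"
    using cas by (intro cas_heads_eq_tails[of G]) simp
  \<comment> \<open>\<open>tl (awalk_verts u p)\<close> is exactly the list of heads. Cancelling
    \<open>u\<close> in \<open>eq\<close> then carries distinctness over to the tails.\<close>
  have snd: "distinct (map snd p)"
    using u awalk_verts_conv'[OF cas] by auto
  have mset: "mset (map snd p) = mset (map fst p)"
    using arg_cong[OF eq, of mset] by simp
  have fst: "distinct (map fst p)"
    using mset snd mset_eq_imp_distinct_iff by blast
  obtain e1 e2 e3 e4 q where p: "p = e1 # e2 # e3 # e4 # q"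
    using assms(3) by (auto simp: numeral_eq_Suc Suc_le_length_iff)
  have ends: "snd e1 = fst e2" "snd e2 = fst e3" "snd e3 = fst e4"
    using eq by (auto simp: p)
  have "snd ` set p = fst ` set p"
    using arg_cong[OF mset, of set_mset] by simp
  then have "snd e4 \<in> fst ` set p"
    by (force simp: p)
  moreover have "p = (fst e1, fst e2) # (fst e2, fst e3) # (fst e3, fst e4) # (fst e4, snd e4) # q"
    using p ends by (metis prod.collapse)
  ultimately show thesis
    using that fst snd u(1) unfolding awalk_def by blast
qed

text \<open>If \<open>b\<close> or \<open>d\<close> is in \<open>I\<close>, its two neighbors on the
  cycle lie in the clique \<open>K\<close> and form a chord (\<open>ac\<close> or
  \<open>ce\<close>). Otherwise \<open>b\<close> and \<open>d\<close> are both in \<open>K\<close>,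
  and \<open>bd\<close> is a chord.\<close>

lemma threshold_graph_imp_chordal:
  assumes "threshold_graph G"
  shows "chordal G"
proof -
  have G: "pair_graph G"
    using assms by (auto simp: threshold_graph_def)
  interpret pair_graph G by fact
  obtain K I where split: "split_graph G K I"
    using assms by (auto simp: threshold_graph_def)
  have KI: "K \<union> I = pverts G" and
    clique: "\<And>x y. x \<in> K \<Longrightarrow> y \<in> K \<Longrightarrow> x \<noteq> y \<Longrightarrow> (x, y) \<in> parcs G"
    using split by (auto simp: split_graph_def clique_def pairwise_def)
  have nbr: "x \<in> K" if "y \<in> I" "(x, y) \<in> parcs G \<or> (y, x) \<in> parcs G" for x y
    using split_graph_nbhd_independent[OF G split that(1)] that(2) graph_symmetric
    by (auto simp: nbhd_def)
  have "\<exists>u v. chord G p u v" if cyc: "graph_cycle G p" "4 \<le> length p" for p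
  proof -
    obtain a b c d e q where p: "p = (a, b) # (b, c) # (c, d) # (d, e) # q"
      and e: "e \<in> fst ` set p" and dist: "distinct (map fst p)" "distinct (map snd p)"
      and arcs: "set p \<subseteq> parcs G"
      by (rule graph_cycle_expand[OF G cyc])
    have unique: "(x, y) \<in> set p \<Longrightarrow> (x, z) \<in> set p \<Longrightarrow> y = z"
      "(y, x) \<in> set p \<Longrightarrow> (z, x) \<in> set p \<Longrightarrow> y = z" for x y z
      using dist unfolding distinct_map by (metis fst_conv snd_conv inj_onD prod.inject)+
    have "(a, b) \<in> set p" "(b, c) \<in> set p" "(c, d) \<in> set p" "(d, e) \<in> set p"
      by (auto simp: p)
    note in_p = this
    have ac: "(a, b) \<in> parcs G" "(b, c) \<in> parcs G" "(c, d) \<in> parcs G" "(d, e) \<in> parcs G"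
      using in_p arcs by auto
    have ne: "a \<noteq> b" "b \<noteq> c" "c \<noteq> d" "d \<noteq> e" "a \<noteq> c" "a \<noteq> d" "b \<noteq> d" "c \<noteq> e"
      using dist ac no_loops' by (auto simp: p)
    \<comment> \<open>The arc \<open>(x, z)\<close> cannot be on the cycle, since
      \<open>(x, y)\<close> already leaves \<open>x\<close>. The reverse arc would close a triangle
      and is excluded case by case.\<close>
    have ch: "chord G p x z"
      if "(x, y) \<in> set p" "(y, z) \<in> set p" "x \<noteq> y" "y \<noteq> z" "(z, x) \<notin> set p"
        "x \<in> K" "z \<in> K" "x \<noteq> z" "z \<in> fst ` set p" for x y z
    proof -
      have "x \<in> fst ` set p"
        using that(1) by force
      moreover have "(x, z) \<notin> set p"
        using that(1,4) unique(1) by blast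
      ultimately show ?thesis
        using that clique[of x z] by (simp add: chord_def)
    qed
    consider "b \<in> I" | "d \<in> I" | "b \<in> K" "d \<in> K"
      using KI in_arcsD2[OF ac(1)] in_arcsD2[OF ac(3)] by auto
    then show ?thesis
    proof cases
      case 1
      have "(c, a) \<notin> set p" using unique(1)[OF in_p(3)] ne by auto
      moreover have "c \<in> fst ` set p" by (simp add: p)
      ultimately show ?thesis using ch[OF in_p(1,2)] 1 nbr[OF 1] ac ne by blast
    next
      case 2
      \<comment> \<open>Only \<open>(b, c)\<close> enters \<open>c\<close>, so \<open>(e, c)\<close>
        on the cycle would give \<open>e = b\<close>; then both \<open>(a, b)\<close> and
        \<open>(d, b)\<close> enter \<open>b\<close>, contradicting
        \<open>a \<noteq> d\<close>.\<close>
      have "(e, c) \<notin> set p" using unique(2)[OF in_p(2)] unique(2)[OF in_p(1)] in_p(4) ne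
        by metis
      then show ?thesis using ch[OF in_p(3,4)] 2 nbr[OF 2] ac ne e by blast
    next
      case 3
      have "(d, b) \<notin> set p" using unique(2)[OF in_p(1)] ne by auto
      moreover have "d \<in> fst ` set p" by (simp add: p)
      ultimately show ?thesis using 3 ch[OF in_p(2,3)] ne by blast
    qed
  qed
  then show ?thesis
    using G by (auto simp: chordal_def)
qed

section \<open>Maximal cliques and their enumeration\<close>

lemma clique_insert_nbhd:
  assumes "pair_graph G" "split_graph G K I" "w \<in> I"
  shows "clique G (insert w (nbhd G w))"
proof -
  interpret pair_graph G by fact
  have "nbhd G w \<subseteq> K"
    by (rule split_graph_nbhd_independent) fact+
  moreover have "w \<in> pverts G" "(x, w) \<in> parcs G" if "x \<in> nbhd G w" for x
    using that graph_symmetric in_arcsD1 by (auto simp: nbhd_def)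
  moreover have "w \<in> pverts G" "clique G K"
    using assms(2,3) by (auto simp: split_graph_def)
  ultimately show ?thesis
    unfolding clique_def pairwise_def nbhd_def by blast
qed

lemma clique_subset_insert_nbhd:
  assumes "clique G C" "w \<in> C"
  shows "C \<subseteq> insert w (nbhd G w)"
  using assms by (auto simp: clique_def pairwise_def nbhd_def)

text \<open>A clique containing some \<open>w\<close> in \<open>I\<close> lies in the closed
  neighborhood of \<open>w\<close>, itself a clique; a clique avoiding \<open>I\<close> lies in
  \<open>K\<close>. Intersecting with \<open>{K}\<close> contributes \<open>K\<close> exactly when
  it is maximal.\<close>

lemma maximal_cliques_split_graph:
  assumes "pair_graph G" "split_graph G K I"
  shows "maximal_cliques G
    = (maximal_cliques G \<inter> {K}) \<union> (\<lambda>w. insert w (nbhd G w)) ` I"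
proof (intro equalityI subsetI)
  fix C assume C: "C \<in> maximal_cliques G"
  then have "clique G C" and max: "\<And>D. clique G D \<Longrightarrow> C \<subseteq> D \<Longrightarrow> D = C"
    by (auto simp: maximal_cliques_def)
  show "C \<in> (maximal_cliques G \<inter> {K}) \<union> (\<lambda>w. insert w (nbhd G w)) ` I"
  proof (cases "C \<inter> I = {}")
    case True
    then have "C \<subseteq> K" "clique G K"
      using assms(2) \<open>clique G C\<close> by (auto simp: split_graph_def clique_def)
    then show ?thesis using max C by auto
  next
    case False
    then obtain w where "w \<in> C" "w \<in> I" by auto
    then show ?thesis
      using max clique_insert_nbhd[OF assms] clique_subset_insert_nbhd[OF \<open>clique G C\<close>] by blast
  qed
next
  fix C assume "C \<in> (maximal_cliques G \<inter> {K}) \<union> (\<lambda>w. insert w (nbhd G w)) ` I"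
  then show "C \<in> maximal_cliques G"
    using clique_insert_nbhd[OF assms] clique_subset_insert_nbhd
    by (fastforce simp: maximal_cliques_def)
qed

text \<open>The two alternatives correspond to vertices of \<open>K\<close> (a prefix) and of
  \<open>I\<close> (one position). Both index sets are nonempty, as connectedness of the induced
  subgraph will require.\<close>

lemma threshold_graph_clique_enumeration:
  assumes "threshold_graph G"
  obtains Cs where "distinct Cs" "set Cs = maximal_cliques G"
    "\<And>v. v \<in> pverts G \<Longrightarrow>
       (\<exists>k. 0 < k \<and> k \<le> length Cs \<and> {i. i < length Cs \<and> v \<in> Cs ! i} = {..<k}) \<or>
       (\<exists>k < length Cs. {i. i < length Cs \<and> v \<in> Cs ! i} = {k})"
proof -
  have G: "pair_graph G"
    using assms by (auto simp: threshold_graph_def)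
  obtain K I vs where split: "split_graph G K I" and vs: "distinct vs" "set vs = I"
    and step: "\<And>i. Suc i < length vs \<Longrightarrow> nbhd G (vs ! i) \<subseteq> nbhd G (vs ! Suc i)"
    using assms by (auto simp: threshold_graph_def nested_neighborhoods_def)
  have K: "K \<inter> I = {}" "K \<union> I = pverts G" "clique G K"
    using split by (auto simp: split_graph_def)
  have NK: "nbhd G w \<subseteq> K" if "w \<in> I" for w
    using split_graph_nbhd_independent[OF G split that] .
  let ?N = "\<lambda>w. insert w (nbhd G w)"
  \<comment> \<open>\<open>vs\<close> has increasing neighborhoods, so it is reversed;
    \<open>K\<close>, if maximal, has the largest trace on \<open>K\<close> and goes first.\<close>
  define Cs where "Cs = (if K \<in> maximal_cliques G then [K] else []) @ map ?N (rev vs)"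
  have set: "set Cs = maximal_cliques G"
    by (subst maximal_cliques_split_graph[OF G split]) (auto simp: Cs_def vs(2))
  have trace: "?N w \<inter> I = {w}" if "w \<in> I" for w
    using NK[OF that] K that by auto
  have "inj_on ?N I"
    by (rule inj_onI) (metis trace singleton_inject)
  moreover have "K \<noteq> ?N w" if "w \<in> I" for w
    using that K by auto
  ultimately have dist: "distinct Cs"
    using vs by (auto simp: Cs_def distinct_map)
  have "transp (\<lambda>x y. nbhd G x \<subseteq> nbhd G y)"
    by (auto intro: transpI)
  then have "sorted_wrt (\<lambda>x y. nbhd G x \<subseteq> nbhd G y) vs"
    using step by (simp add: sorted_wrt_iff_nth_Suc_transp)
  then have "sorted_wrt (\<lambda>x y. nbhd G y \<subseteq> nbhd G x) (rev vs)"
    by (simp add: sorted_wrt_rev)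
  \<comment> \<open>Intersecting with \<open>K\<close> removes the added vertex of \<open>I\<close>,
    leaving just the nested open neighborhoods.\<close>
  then have "sorted_wrt (\<lambda>x y. ?N y \<inter> K \<subseteq> ?N x \<inter> K) (rev vs)"
    by (rule sorted_wrt_mono_rel[rotated]) (use vs K in auto)
  then have sorted: "sorted_wrt (\<lambda>C D. D \<inter> K \<subseteq> C \<inter> K) Cs"
    by (auto simp: Cs_def sorted_wrt_map)
  have ex: "\<exists>C \<in> set Cs. v \<in> C" if "v \<in> pverts G" for v
  proof (cases "v \<in> I")
    case True
    then show ?thesis using vs by (auto simp: Cs_def)
  next
    case False
    then have "v \<in> K" using K that by auto
    show ?thesis
    proof (cases "K \<in> maximal_cliques G")
      case True
      then show ?thesis using \<open>v \<in> K\<close> set by auto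
    next
      case False
      \<comment> \<open>A clique \<open>D\<close> properly extending \<open>K\<close> contains some
        \<open>w\<close> in \<open>I\<close>, and then \<open>w\<close> is adjacent to all of
        \<open>K\<close>.\<close>
      then obtain D where D: "clique G D" "K \<subseteq> D" "D \<noteq> K"
        using K by (auto simp: maximal_cliques_def)
      then obtain w where "w \<in> D" "w \<in> I"
        using K unfolding clique_def by blast
      then have "v \<in> ?N w"
        using clique_subset_insert_nbhd[OF D(1)] D(2) \<open>v \<in> K\<close> by blast
      then show ?thesis using \<open>w \<in> I\<close> vs by (auto simp: Cs_def)
    qed
  qed
  have "(\<exists>k. 0 < k \<and> k \<le> length Cs \<and> {i. i < length Cs \<and> v \<in> Cs ! i} = {..<k}) \<or>
       (\<exists>k < length Cs. {i. i < length Cs \<and> v \<in> Cs ! i} = {k})" if v: "v \<in> pverts G" for v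
  proof (cases "v \<in> I")
    case True
    have only: "C = ?N v" if "C \<in> set Cs" "v \<in> C" for C
      using that True vs K trace by (auto simp: Cs_def split: if_splits)
    obtain k where k: "k < length Cs" "v \<in> Cs ! k"
      using ex[OF v] by (auto simp: in_set_conv_nth)
    have "i = k" if "i < length Cs" "v \<in> Cs ! i" for i
      using that k only[OF nth_mem] dist by (metis nth_eq_iff_index_eq)
    then have "{i. i < length Cs \<and> v \<in> Cs ! i} = {k}"
      using k by blast
    then show ?thesis using k by blast
  next
    case False
    then have "v \<in> K" using v K by auto
    let ?P = "\<lambda>i. i < length Cs \<and> v \<in> Cs ! i"
    obtain j where j: "?P j"
      using ex[OF v] by (auto simp: in_set_conv_nth)
    \<comment> \<open>Decreasing traces make the index set of \<open>v\<close> downward closed, so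
      its largest element \<open>m\<close> determines the prefix, of length
      \<open>Suc m\<close>.\<close>
    define m where "m = Max {i. ?P i}"
    have fin: "finite {i. ?P i}" by auto
    have m: "?P m"
      using Max_in[OF fin] j unfolding m_def by blast
    have "?P i" if "i \<le> m" for i
      using sorted_wrt_nth_less[OF sorted, of i m] that m \<open>v \<in> K\<close>
      by (cases "i = m") auto
    moreover have "i \<le> m" if "?P i" for i
      using that fin unfolding m_def by auto
    ultimately have "{i. ?P i} = {..<Suc m}"
      unfolding lessThan_def less_Suc_eq_le by blast
    moreover have "0 < Suc m" "Suc m \<le> length Cs"
      using m by auto
    ultimately show ?thesis
      by blast
  qed
  then show thesis
    using that dist set by blast
qed

section \<open>Matching tree nodes with maximal cliques\<close>

lemma threshold_graph_clique_tree:
  assumes thr: "threshold_graph G" and tree: "graph_tree T"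
    and card: "card (pverts T) = card (maximal_cliques G)"
  shows "clique_tree T G"
proof -
  interpret T: pair_graph T
    using tree by (simp add: graph_tree_def)
  obtain us where us: "distinct us" "set us = pverts T"
    and prefix: "\<And>k. 0 < k \<Longrightarrow> k \<le> length us \<Longrightarrow> connected (with_proj T \<restriction> set (take k us))"
    using connected_prefix_enumeration[of "with_proj T"] tree T.pair_finite_verts
    by (auto simp: graph_tree_def)
  obtain Cs where Cs: "distinct Cs" "set Cs = maximal_cliques G"
    and shape: "\<And>v. v \<in> pverts G \<Longrightarrow>
       (\<exists>k. 0 < k \<and> k \<le> length Cs \<and> {i. i < length Cs \<and> v \<in> Cs ! i} = {..<k}) \<or>
       (\<exists>k < length Cs. {i. i < length Cs \<and> v \<in> Cs ! i} = {k})"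
    by (rule threshold_graph_clique_enumeration[OF thr]) blast
  have len: "length Cs = length us"
    using us Cs card by (metis distinct_card)
  \<comment> \<open>\<open>\<iota>\<close> gives the position of a node in \<open>us\<close>;
    composing it with \<open>(!) Cs\<close> assigns to each node the clique at the same
    position.\<close>
  define \<iota> where "\<iota> = inv_into {..<length us} ((!) us)"
  have bij_us: "bij_betw ((!) us) {..<length us} (pverts T)"
    using us by (intro bij_betw_nth) auto
  have \<iota>: "\<iota> (us ! i) = i" if "i < length us" for i
    using that bij_us by (auto simp: \<iota>_def bij_betw_def)
  have "bij_betw \<iota> (pverts T) {..<length us}"
    unfolding \<iota>_def by (rule bij_betw_inv_into[OF bij_us])
  moreover have "bij_betw ((!) Cs) {..<length us} (maximal_cliques G)"
    using Cs len by (intro bij_betw_nth) auto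
  ultimately have bij: "bij_betw ((!) Cs \<circ> \<iota>) (pverts T) (maximal_cliques G)"
    by (rule bij_betw_trans)
  have "connected (with_proj T \<restriction> {u \<in> pverts T. v \<in> ((!) Cs \<circ> \<iota>) u})" if v: "v \<in> pverts G" for v
  proof -
    \<comment> \<open>The nodes whose cliques contain \<open>v\<close> are read off from the
      positions of these cliques in \<open>Cs\<close>: a prefix of \<open>us\<close> or a single
      node.\<close>
    have "{u \<in> pverts T. v \<in> ((!) Cs \<circ> \<iota>) u} = (!) us ` {i. i < length Cs \<and> v \<in> Cs ! i}"
      using \<iota> len by (auto simp: us(2)[symmetric] in_set_conv_nth)
    moreover have "(!) us ` {..<k} = set (take k us)" if "k \<le> length us" for k
      using that by (simp add: nth_image lessThan_atLeast0)
    ultimately show ?thesis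
      using shape[OF v] prefix len by (auto simp: connected_induce_singleton)
  qed
  then show ?thesis
    using tree bij unfolding clique_tree_def by blast
qed

theorem corollary5p1:
  fixes G :: "'a pair_pre_digraph"
  assumes "threshold_graph G"
  shows "clique_tree_universal TYPE('b) G"
  using assms threshold_graph_imp_chordal threshold_graph_clique_tree
  unfolding clique_tree_universal_def by blast

end
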